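(* Let $C_2=\{e,g\}$ be the cyclic group of order $2$ with identity $e$, and let $S_2$ be the semigroup with underlying set $\{1,2\}\times C_2\times\{1,2\}$ and multiplication $(i,x,\lambda)\cdot(j,y,\mu)=(i,x\,p_{\lambda j}\,y,\mu)$, where $p_{11}=p_{12}=p_{21}=e$ and $p_{22}=g$. Then $S_2$ is $2$-supernilpotent.
   Context: $\mathbb{N}$ is the set of positive integers. Commutators. Let $\mathbf{A}$ be an algebra, $\operatorname{Con}(\mathbf{A})$ its congruence lattice with least element $0_A$ (equality) and greatest element $1_A=A\times A$, and $\operatorname{Pol}(\mathbf{A})$ its set of polynomial operations (operations built from the basic operations, variables and constants from $A$; for a semigroup, products of variables and constants). For tuples, $\mathbf{x}\;\alpha\;\mathbf{y}$ means coordinatewise relatedness. For $k\ge 1$ and $\alpha_1,\dots,\alpha_k,\beta,\delta\in\operatorname{Con}(\mathbf{A})$, the condition $C(\alpha_1,\dots,\alpha_k,\beta;\delta)$ means: for all $n_1,\dots,n_k,m\in\mathbb{N}$, every $p\in\operatorname{Pol}(\mathbf{A})$ of arity $n_1+\dots+n_k+m$, and all $\mathbf{a}_j,\mathbf{b}_j\in A^{n_j}$ with $\mathbf{a}_j\;\alpha_j\;\mathbf{b}_j$ ($j=1,\dots,k$) and $\mathbf{c},\mathbf{d}\in A^m$ with $\mathbf{c}\;\beta\;\mathbf{d}$: if $p(\mathbf{x}_1,\dots,\mathbf{x}_k,\mathbf{c})\;\delta\;p(\mathbf{x}_1,\dots,\mathbf{x}_k,\mathbf{d})$ for all choices $\mathbf{x}_j\in\{\mathbf{a}_j,\mathbf{b}_j\}$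 other than the choice $(\mathbf{x}_1,\dots,\mathbf{x}_k)=(\mathbf{b}_1,\dots,\mathbf{b}_k)$, then $p(\mathbf{b}_1,\dots,\mathbf{b}_k,\mathbf{c})\;\delta\;p(\mathbf{b}_1,\dots,\mathbf{b}_k,\mathbf{d})$. For $k\ge 2$, the $k$-ary commutator $[\alpha_1,\dots,\alpha_k]$ is the smallest congruence $\delta$ with $C(\alpha_1,\dots,\alpha_k;\delta)$ (with $\alpha_k$ in the role of $\beta$). An algebra $\mathbf{A}$ is $n$-supernilpotent if $[\,\underbrace{1_A,\dots,1_A}_{n+1}\,]=0_A$. In particular, $2$-supernilpotent means $[1_A,1_A,1_A]=0_A$. *)

theory Defs
  imports "HOL-Algebra.Elementary_Groups"
begin

text \<open>A basic operation is given by its arity together with a function on argument lists, of which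
  only the values on lists of that length over the carrier matter.\<close>

record 'a univ_algebra = "'a partial_object" +
  basic_ops :: "(nat \<times> ('a list \<Rightarrow> 'a)) set"

inductive_set Pol :: "('a, 'm) univ_algebra_scheme \<Rightarrow> nat \<Rightarrow> ('a list \<Rightarrow> 'a) set"
  for A :: "('a, 'm) univ_algebra_scheme" and n :: nat where
  const: "a \<in> carrier A \<Longrightarrow> (\<lambda>_. a) \<in> Pol A n"
| var: "i < n \<Longrightarrow> (\<lambda>xs. xs ! i) \<in> Pol A n"
| app: "\<lbrakk>(length ps, f) \<in> basic_ops A; \<forall>p\<in>set ps. p \<in> Pol A n\<rbrakk>
    \<Longrightarrow> (\<lambda>xs. f (map (\<lambda>p. p xs) ps)) \<in> Pol A n"

definition Con :: "('a, 'm) univ_algebra_scheme \<Rightarrow> ('a \<times> 'a) set set" where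
  "Con A = {\<theta>. equiv (carrier A) \<theta> \<and>
     (\<forall>(n, f)\<in>basic_ops A. \<forall>xs ys. length xs = n \<longrightarrow> (xs, ys) \<in> listrel \<theta> \<longrightarrow> (f xs, f ys) \<in> \<theta>)}"

definition zero_con :: "('a, 'm) univ_algebra_scheme \<Rightarrow> ('a \<times> 'a) set" where
  "zero_con A = Id_on (carrier A)"

definition one_con :: "('a, 'm) univ_algebra_scheme \<Rightarrow> ('a \<times> 'a) set" where
  "one_con A = carrier A \<times> carrier A"

text \<open>The choice made in block \<open>j\<close> is \<open>b\<^sub>j\<close> for \<open>j \<in> T\<close> and \<open>a\<^sub>j\<close> otherwise.  Choices are sets of
  positions rather than tuples of values: if some \<open>a\<^sub>j\<close> equals \<open>b\<^sub>j\<close>, then choosing \<open>a\<^sub>j\<close> there is still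
  a choice different from choosing \<open>b\<close> everywhere.\<close>

definition choose_blocks :: "nat set \<Rightarrow> 'a list list \<Rightarrow> 'a list list \<Rightarrow> 'a list" where
  "choose_blocks T as bs = concat (map (\<lambda>j. if j \<in> T then bs ! j else as ! j) [0..<length as])"

text \<open>\<open>centralizes A [\<alpha>\<^sub>1, \<dots>, \<alpha>\<^sub>k] \<beta> \<delta>\<close> is the condition \<open>C(\<alpha>\<^sub>1, \<dots>, \<alpha>\<^sub>k, \<beta>; \<delta>)\<close>.\<close>

definition centralizes ::
  "('a, 'm) univ_algebra_scheme \<Rightarrow> ('a \<times> 'a) set list \<Rightarrow> ('a \<times> 'a) set \<Rightarrow> ('a \<times> 'a) set \<Rightarrow> bool" where
  "centralizes A \<alpha>s \<beta> \<delta> \<longleftrightarrow>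
    (\<forall>as bs c d. \<forall>p \<in> Pol A (length (concat as) + length c).
       length as = length \<alpha>s \<longrightarrow> length bs = length \<alpha>s \<longrightarrow>
       (\<forall>j<length \<alpha>s. as ! j \<noteq> [] \<and> (as ! j, bs ! j) \<in> listrel (\<alpha>s ! j)) \<longrightarrow>
       c \<noteq> [] \<longrightarrow> (c, d) \<in> listrel \<beta> \<longrightarrow>
       (\<forall>T. T \<subset> {..<length \<alpha>s} \<longrightarrow>
          (p (choose_blocks T as bs @ c), p (choose_blocks T as bs @ d)) \<in> \<delta>) \<longrightarrow>
       (p (concat bs @ c), p (concat bs @ d)) \<in> \<delta>)"

text \<open>Congruences are ordered by inclusion, so \<open>LEAST\<close> is the smallest congruence with the property.
  It exists because the property is closed under intersections and \<open>one_con A\<close> has it (for an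
  algebra whose basic operations preserve the carrier).  The list of arguments is to have length at
  least 2.\<close>

definition commutator :: "('a, 'm) univ_algebra_scheme \<Rightarrow> ('a \<times> 'a) set list \<Rightarrow> ('a \<times> 'a) set" where
  "commutator A \<alpha>s = (LEAST \<delta>. \<delta> \<in> Con A \<and> centralizes A (butlast \<alpha>s) (last \<alpha>s) \<delta>)"

definition supernilpotent :: "nat \<Rightarrow> ('a, 'm) univ_algebra_scheme \<Rightarrow> bool" where
  "supernilpotent n A \<longleftrightarrow> commutator A (replicate (n + 1) (one_con A)) = zero_con A"

definition semigroup_algebra :: "'a set \<Rightarrow> ('a \<Rightarrow> 'a \<Rightarrow> 'a) \<Rightarrow> 'a univ_algebra" where
  "semigroup_algebra S mul = \<lparr>carrier = S, basic_ops = {(2, \<lambda>xs. mul (xs ! 0) (xs ! 1))}\<rparr>"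

text \<open>The parameters are the group \<open>C\<^sub>2\<close> and its non-identity element \<open>g\<close>.\<close>

definition sandwich :: "('g, 'm) monoid_scheme \<Rightarrow> 'g \<Rightarrow> nat \<Rightarrow> nat \<Rightarrow> 'g" where
  "sandwich G g l j = (if l = 2 \<and> j = 2 then g else \<one>\<^bsub>G\<^esub>)"

definition S2_mult ::
  "('g, 'm) monoid_scheme \<Rightarrow> 'g \<Rightarrow> nat \<times> 'g \<times> nat \<Rightarrow> nat \<times> 'g \<times> nat \<Rightarrow> nat \<times> 'g \<times> nat" where
  "S2_mult G g = (\<lambda>(i, x, l) (j, y, \<mu>). (i, x \<otimes>\<^bsub>G\<^esub> sandwich G g l j \<otimes>\<^bsub>G\<^esub> y, \<mu>))"

definition S2 :: "('g, 'm) monoid_scheme \<Rightarrow> 'g \<Rightarrow> (nat \<times> 'g \<times> nat) univ_algebra" where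
  "S2 G g = semigroup_algebra ({1, 2} \<times> carrier G \<times> {1, 2}) (S2_mult G g)"

end

theory Submission
  imports Defs
begin

text \<open>
  The semigroup is a Rees matrix semigroup over an abelian group, and the result holds for all of
  these (\<open>rees_matrix_supernilpotent\<close>). In a product of elements \<open>(i\<^sub>k, x\<^sub>k, l\<^sub>k)\<close> the first index is
  that of the first factor, the last index is that of the last factor, and the group component is
  the product of the \<open>x\<^sub>k\<close> and of the sandwich entries at \<open>(l\<^sub>k, i\<^sub>k\<^sub>+\<^sub>1)\<close>. A sandwich entry depends on
  two adjacent factors only, so the group component is a function of ``degree'' at most 2 in the
  factors.

  The ternary term condition evaluates a polynomial at the eight vertices of a cube, whose three
  directions exchange \<open>a\<^sub>1\<close> with \<open>b\<^sub>1\<close>, \<open>a\<^sub>2\<close> with \<open>b\<^sub>2\<close>, and \<open>c\<close> with \<open>d\<close>. Each of the two indices of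
  the value varies along at most one direction. A group-valued function that varies along at most
  two directions has a trivial alternating product over the cube (\<open>balanced_of_biaxial\<close>), and the
  functions with a trivial alternating product are closed under multiplication because the group
  is abelian (\<open>balanced_mult\<close>); hence the group component of every polynomial has a trivial
  alternating product (\<open>Pol_cubical\<close>). If it takes equal values at the ends of three of the four
  edges from \<open>c\<close> to \<open>d\<close>, then cancellation gives equality on the fourth edge
  (\<open>balanced_edge_eq\<close>). An index that varies along one direction only and is constant along one of
  these edges is constant along all of them (\<open>uniaxial_edge_eq\<close>). Together this is the term
  condition for the equality relation.
\<close>

section \<open>Functions on the three-dimensional cube\<close>

definition uniaxial :: "(bool \<Rightarrow> bool \<Rightarrow> bool \<Rightarrow> 'a) \<Rightarrow> bool" where
  "uniaxial f \<longleftrightarrow> (\<exists>h. f = (\<lambda>r s t. h r)) \<or> (\<exists>h. f = (\<lambda>r s t. h s)) \<or> (\<exists>h. f = (\<lambda>r s t. h t))"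

definition biaxial :: "(bool \<Rightarrow> bool \<Rightarrow> bool \<Rightarrow> 'a) \<Rightarrow> bool" where
  "biaxial f \<longleftrightarrow>
    (\<forall>s t. f False s t = f True s t) \<or> (\<forall>r t. f r False t = f r True t) \<or>
    (\<forall>r s. f r s False = f r s True)"

text \<open>The product over the even vertices is equated with that over the odd vertices: this is the
  vanishing of the third-order difference, written without inverses.\<close>

definition balanced :: "('g, 'm) monoid_scheme \<Rightarrow> (bool \<Rightarrow> bool \<Rightarrow> bool \<Rightarrow> 'g) \<Rightarrow> bool" where
  "balanced G q \<longleftrightarrow>
    q False False False \<otimes>\<^bsub>G\<^esub> q True True False \<otimes>\<^bsub>G\<^esub> q True False True \<otimes>\<^bsub>G\<^esub> q False True True =
    q True False False \<otimes>\<^bsub>G\<^esub> q False True False \<otimes>\<^bsub>G\<^esub> q False False True \<otimes>\<^bsub>G\<^esub> q True True True"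

lemma uniaxialI:
  "uniaxial (\<lambda>r s t. h r)" "uniaxial (\<lambda>r s t. h s)" "uniaxial (\<lambda>r s t. h t)"
  unfolding uniaxial_def by auto

lemma uniaxial_comp: "uniaxial f \<Longrightarrow> uniaxial (\<lambda>r s t. g (f r s t))"
  unfolding uniaxial_def by fast

lemma biaxial_combine:
  assumes "uniaxial f" and "uniaxial g"
  shows "biaxial (\<lambda>r s t. P (f r s t) (g r s t))"
  using assms unfolding uniaxial_def biaxial_def by (elim disjE exE) simp_all

lemma biaxial_of_uniaxial: "uniaxial f \<Longrightarrow> biaxial f"
  using biaxial_combine[of f f "\<lambda>x y. x"] by simp

lemma uniaxial_edge_eq:
  assumes "uniaxial f" and "f False False False = f False False True"
  shows "f True True False = f True True True"
  using assms unfolding uniaxial_def by auto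

text \<open>Along a direction in which the function is constant, each even vertex is matched with an
  odd vertex of the same value.\<close>

lemma (in comm_group) balanced_of_biaxial:
  assumes "biaxial q" and "\<And>r s t. q r s t \<in> carrier G"
  shows "balanced G q"
  using assms(1) unfolding biaxial_def balanced_def
  by (elim disjE) (simp_all add: assms(2) m_ac)

lemma (in comm_group) balanced_mult:
  assumes "balanced G p" and "balanced G q"
    and p: "\<And>r s t. p r s t \<in> carrier G" and q: "\<And>r s t. q r s t \<in> carrier G"
  shows "balanced G (\<lambda>r s t. p r s t \<otimes> q r s t)"
proof -
  have shuffle: "(a \<otimes> a') \<otimes> (b \<otimes> b') \<otimes> (c \<otimes> c') \<otimes> (d \<otimes> d') = (a \<otimes> b \<otimes> c \<otimes> d) \<otimes> (a' \<otimes> b' \<otimes> c' \<otimes> d')"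
    if "a \<in> carrier G" "b \<in> carrier G" "c \<in> carrier G" "d \<in> carrier G"
      "a' \<in> carrier G" "b' \<in> carrier G" "c' \<in> carrier G" "d' \<in> carrier G" for a b c d a' b' c' d'
    using that by (simp add: m_ac)
  show ?thesis
    using assms(1,2) unfolding balanced_def by (simp only: shuffle p q)
qed

text \<open>The three edges with equal ends cancel, which leaves one factor on either side.\<close>

lemma (in comm_group) balanced_edge_eq:
  assumes "balanced G q" and q: "\<And>r s t. q r s t \<in> carrier G"
    and "q False False False = q False False True"
    and "q True False False = q True False True"
    and "q False True False = q False True True"
  shows "q True True False = q True True True"
proof -
  let ?k = "q False False True \<otimes> q True False True \<otimes> q False True True"
  have "?k \<otimes> q True True False = ?k \<otimes> q True True True"
    using assms(1) unfolding balanced_def assms(3-5) by (simp add: q m_ac)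
  then show ?thesis by (simp add: q)
qed

section \<open>Polynomials of Rees matrix semigroups on a cube\<close>

definition rees_mult ::
  "('g, 'm) monoid_scheme \<Rightarrow> ('l \<Rightarrow> 'i \<Rightarrow> 'g) \<Rightarrow> 'i \<times> 'g \<times> 'l \<Rightarrow> 'i \<times> 'g \<times> 'l \<Rightarrow> 'i \<times> 'g \<times> 'l" where
  "rees_mult G P = (\<lambda>(i, x, l) (j, y, m). (i, x \<otimes>\<^bsub>G\<^esub> P l j \<otimes>\<^bsub>G\<^esub> y, m))"

text \<open>The invariant of the induction over polynomials. It is not enough to carry the balance of the
  group component along: the sandwich entry that a multiplication inserts is balanced only because
  each of the two indices is uniaxial.\<close>

definition cubical ::
  "('g, 'm) monoid_scheme \<Rightarrow> 'i set \<Rightarrow> 'l set \<Rightarrow> (bool \<Rightarrow> bool \<Rightarrow> bool \<Rightarrow> 'i \<times> 'g \<times> 'l) \<Rightarrow> bool" where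
  "cubical G I L f \<longleftrightarrow>
    (\<forall>r s t. f r s t \<in> I \<times> carrier G \<times> L) \<and>
    uniaxial (\<lambda>r s t. fst (f r s t)) \<and> uniaxial (\<lambda>r s t. snd (snd (f r s t))) \<and>
    balanced G (\<lambda>r s t. fst (snd (f r s t)))"

lemma (in comm_group) cubical_of_uniaxial:
  assumes "uniaxial f" and "\<And>r s t. f r s t \<in> I \<times> carrier G \<times> L"
  shows "cubical G I L f"
proof -
  have "fst (snd (f r s t)) \<in> carrier G" for r s t
    using assms(2)[of r s t] by auto
  then have "balanced G (\<lambda>r s t. fst (snd (f r s t)))"
    by (intro balanced_of_biaxial biaxial_of_uniaxial uniaxial_comp[OF assms(1)])
  then show ?thesis
    unfolding cubical_def by (intro conjI allI assms(2) uniaxial_comp[OF assms(1)])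
qed

text \<open>The sandwich entry combines a right index with a left index, hence varies along at most two
  directions and is balanced.\<close>

lemma (in comm_group) cubical_rees_mult:
  assumes P: "\<And>l i. l \<in> L \<Longrightarrow> i \<in> I \<Longrightarrow> P l i \<in> carrier G"
    and f: "cubical G I L f" and h: "cubical G I L h"
  shows "cubical G I L (\<lambda>r s t. rees_mult G P (f r s t) (h r s t))"
proof -
  have fm: "fst (f r s t) \<in> I" "fst (snd (f r s t)) \<in> carrier G" "snd (snd (f r s t)) \<in> L" for r s t
    using f unfolding cubical_def by (metis mem_Times_iff)+
  have hm: "fst (h r s t) \<in> I" "fst (snd (h r s t)) \<in> carrier G" "snd (snd (h r s t)) \<in> L" for r s t
    using h unfolding cubical_def by (metis mem_Times_iff)+
  have eq: "rees_mult G P (f r s t) (h r s t) =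
      (fst (f r s t),
       fst (snd (f r s t)) \<otimes> P (snd (snd (f r s t))) (fst (h r s t)) \<otimes> fst (snd (h r s t)),
       snd (snd (h r s t)))" for r s t
    by (simp add: rees_mult_def case_prod_beta)
  have "balanced G (\<lambda>r s t. P (snd (snd (f r s t))) (fst (h r s t)))"
    using f h unfolding cubical_def
    by (intro balanced_of_biaxial biaxial_combine) (auto simp: P fm hm)
  then have "balanced G (\<lambda>r s t.
      fst (snd (f r s t)) \<otimes> P (snd (snd (f r s t))) (fst (h r s t)) \<otimes> fst (snd (h r s t)))"
    using f h unfolding cubical_def by (intro balanced_mult) (auto simp: P fm hm)
  then show ?thesis
    using f h unfolding cubical_def eq by (simp add: P fm hm)
qed

lemma Pol_semigroup_algebra_induct [consumes 1, case_names const var mult]: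
  assumes "p \<in> Pol (semigroup_algebra S mul) n"
    and "\<And>a. a \<in> S \<Longrightarrow> Q (\<lambda>_. a)"
    and "\<And>i. i < n \<Longrightarrow> Q (\<lambda>xs. xs ! i)"
    and "\<And>p q. Q p \<Longrightarrow> Q q \<Longrightarrow> Q (\<lambda>xs. mul (p xs) (q xs))"
  shows "Q p"
  using assms(1)
proof (induction rule: Pol.induct)
  case (const a)
  then show ?case using assms(2) by (simp add: semigroup_algebra_def)
next
  case (var i)
  then show ?case by (rule assms(3))
next
  case (app ps f)
  then have len: "length ps = 2" and f: "f = (\<lambda>xs. mul (xs ! 0) (xs ! 1))"
    by (simp_all add: semigroup_algebra_def)
  then obtain p q where ps: "ps = [p, q]"
    by (auto simp: numeral_2_eq_2 length_Suc_conv)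
  show ?case
    using app.IH assms(4)[of p q] by (simp add: ps f)
qed

definition cube_point ::
  "'a list \<Rightarrow> 'a list \<Rightarrow> 'a list \<Rightarrow> 'a list \<Rightarrow> 'a list \<Rightarrow> 'a list \<Rightarrow> bool \<Rightarrow> bool \<Rightarrow> bool \<Rightarrow> 'a list" where
  "cube_point a1 b1 a2 b2 c d r s t =
    (if r then b1 else a1) @ (if s then b2 else a2) @ (if t then d else c)"

text \<open>A variable belongs to one of the three blocks and so varies along the direction of that block
  only.\<close>

lemma uniaxial_cube_point_nth:
  assumes "length b1 = length a1" and "length b2 = length a2"
  shows "uniaxial (\<lambda>r s t. cube_point a1 b1 a2 b2 c d r s t ! i)"
proof -
  consider "i < length a1" | "length a1 \<le> i" "i < length a1 + length a2" | "length a1 + length a2 \<le> i"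
    by linarith
  then show ?thesis
  proof cases
    case 1
    then have "(\<lambda>r s t. cube_point a1 b1 a2 b2 c d r s t ! i) = (\<lambda>r s t. (if r then b1 else a1) ! i)"
      using assms by (auto simp: cube_point_def nth_append fun_eq_iff)
    then show ?thesis by (simp only: uniaxialI)
  next
    case 2
    then have "(\<lambda>r s t. cube_point a1 b1 a2 b2 c d r s t ! i) =
        (\<lambda>r s t. (if s then b2 else a2) ! (i - length a1))"
      using assms by (auto simp: cube_point_def nth_append fun_eq_iff)
    then show ?thesis by (simp only: uniaxialI)
  next
    case 3
    then have "(\<lambda>r s t. cube_point a1 b1 a2 b2 c d r s t ! i) =
        (\<lambda>r s t. (if t then d else c) ! (i - length a1 - length a2))"
      using assms by (auto simp: cube_point_def nth_append fun_eq_iff)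
    then show ?thesis by (simp only: uniaxialI)
  qed
qed

lemma (in comm_group) Pol_cubical:
  assumes P: "\<And>l i. l \<in> L \<Longrightarrow> i \<in> I \<Longrightarrow> P l i \<in> carrier G"
    and p: "p \<in> Pol (semigroup_algebra (I \<times> carrier G \<times> L) (rees_mult G P))
      (length a1 + length a2 + length c)"
    and len: "length b1 = length a1" "length b2 = length a2" "length d = length c"
    and mem: "set (a1 @ b1 @ a2 @ b2 @ c @ d) \<subseteq> I \<times> carrier G \<times> L"
  shows "cubical G I L (\<lambda>r s t. p (cube_point a1 b1 a2 b2 c d r s t))"
  using p
proof (induction rule: Pol_semigroup_algebra_induct)
  case (const a)
  then show ?case by (intro cubical_of_uniaxial uniaxialI(1))
next
  case (var i)
  have "cube_point a1 b1 a2 b2 c d r s t ! i \<in> set (cube_point a1 b1 a2 b2 c d r s t)" for r s t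
    using var len by (intro nth_mem) (simp add: cube_point_def)
  moreover have "set (cube_point a1 b1 a2 b2 c d r s t) \<subseteq> I \<times> carrier G \<times> L" for r s t
    using mem by (simp add: cube_point_def)
  ultimately show ?case
    using uniaxial_cube_point_nth[OF len(1,2)] by (intro cubical_of_uniaxial) blast+
next
  case (mult p q)
  then show ?case by (intro cubical_rees_mult P)
qed

section \<open>Supernilpotence of Rees matrix semigroups over abelian groups\<close>

text \<open>Every congruence is reflexive, so equality is the least of all congruences and the commutator
  vanishes as soon as equality is a congruence that satisfies the term condition.\<close>

lemma supernilpotentI:
  assumes "zero_con A \<in> Con A"
    and "centralizes A (replicate n (one_con A)) (one_con A) (zero_con A)"
  shows "supernilpotent n A"
  unfolding supernilpotent_def commutator_def
proof (rule Least_equality)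
  have "replicate (n + 1) (one_con A) = replicate n (one_con A) @ [one_con A]"
    by (simp add: replicate_append_same)
  then show "zero_con A \<in> Con A \<and> centralizes A (butlast (replicate (n + 1) (one_con A)))
      (last (replicate (n + 1) (one_con A))) (zero_con A)"
    using assms by simp
next
  fix \<delta>
  assume "\<delta> \<in> Con A \<and> centralizes A (butlast (replicate (n + 1) (one_con A)))
      (last (replicate (n + 1) (one_con A))) \<delta>"
  then show "zero_con A \<subseteq> \<delta>"
    by (auto simp: Con_def zero_con_def equiv_def refl_on_def)
qed

lemma listrel_Id_on_eq: "(xs, ys) \<in> listrel (Id_on S) \<Longrightarrow> ys = xs \<and> set xs \<subseteq> S"
  by (induction rule: listrel.induct) auto

lemma listrel_Times_set:
  "(xs, ys) \<in> listrel (S \<times> S) \<Longrightarrow> length ys = length xs \<and> set xs \<subseteq> S \<and> set ys \<subseteq> S"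
  by (induction rule: listrel.induct) auto

lemma zero_con_in_Con:
  assumes "\<And>n f xs. (n, f) \<in> basic_ops A \<Longrightarrow> length xs = n \<Longrightarrow> set xs \<subseteq> carrier A \<Longrightarrow> f xs \<in> carrier A"
  shows "zero_con A \<in> Con A"
proof -
  have "equiv (carrier A) (Id_on (carrier A))"
    by (auto simp: equiv_def refl_on_def sym_def trans_def)
  then show ?thesis
    unfolding Con_def zero_con_def using assms by (auto dest!: listrel_Id_on_eq)
qed

lemma (in comm_group) rees_matrix_supernilpotent:
  assumes P: "\<And>l i. l \<in> L \<Longrightarrow> i \<in> I \<Longrightarrow> P l i \<in> carrier G"
  shows "supernilpotent 2 (semigroup_algebra (I \<times> carrier G \<times> L) (rees_mult G P))"
    (is "supernilpotent 2 ?A")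
proof (rule supernilpotentI)
  have carr: "carrier ?A = I \<times> carrier G \<times> L" by (simp add: semigroup_algebra_def)
  have mult_closed: "rees_mult G P x y \<in> I \<times> carrier G \<times> L"
    if "x \<in> I \<times> carrier G \<times> L" "y \<in> I \<times> carrier G \<times> L" for x y
    using that P by (auto simp: rees_mult_def)
  show "zero_con ?A \<in> Con ?A"
  proof (rule zero_con_in_Con)
    fix n f xs
    assume "(n, f) \<in> basic_ops ?A" "length xs = n" "set xs \<subseteq> carrier ?A"
    then have f: "f = (\<lambda>xs. rees_mult G P (xs ! 0) (xs ! 1))" and "length xs = 2"
      and xs: "set xs \<subseteq> I \<times> carrier G \<times> L"
      by (simp_all add: semigroup_algebra_def)
    then have "xs ! 0 \<in> set xs" "xs ! 1 \<in> set xs" by (auto intro: nth_mem)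
    then show "f xs \<in> carrier ?A"
      unfolding f carr using xs by (intro mult_closed) blast+
  qed
  show "centralizes ?A (replicate 2 (one_con ?A)) (one_con ?A) (zero_con ?A)"
    unfolding centralizes_def
  proof (intro allI ballI impI)
    fix as bs c d p
    assume p: "p \<in> Pol ?A (length (concat as) + length c)"
      and "length as = length (replicate 2 (one_con ?A))"
      and "length bs = length (replicate 2 (one_con ?A))"
      and rel: "\<forall>j<length (replicate 2 (one_con ?A)).
        as ! j \<noteq> [] \<and> (as ! j, bs ! j) \<in> listrel (replicate 2 (one_con ?A) ! j)"
      and cd: "(c, d) \<in> listrel (one_con ?A)"
      and hyp: "\<forall>T. T \<subset> {..<length (replicate 2 (one_con ?A))} \<longrightarrow>
        (p (choose_blocks T as bs @ c), p (choose_blocks T as bs @ d)) \<in> zero_con ?A"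
    then obtain a1 a2 b1 b2 where as: "as = [a1, a2]" and bs: "bs = [b1, b2]"
      by (auto simp: numeral_2_eq_2 length_Suc_conv)
    have "(a1, b1) \<in> listrel (one_con ?A)" "(a2, b2) \<in> listrel (one_con ?A)"
      using rel[rule_format, of 0] rel[rule_format, of 1] by (simp_all add: as bs)
    note rels = this[unfolded one_con_def carr, THEN listrel_Times_set]
      cd[unfolded one_con_def carr, THEN listrel_Times_set]
    let ?v = "\<lambda>r s t. p (cube_point a1 b1 a2 b2 c d r s t)"
    have cub: "cubical G I L ?v"
      by (rule Pol_cubical[OF P]) (use p rels as in \<open>simp_all add: add.assoc\<close>)
    have edge: "?v r s False = ?v r s True" if "\<not> (r \<and> s)" for r s
    proof -
      let ?T = "(if r then {0} else {}) \<union> (if s then {1} else {}) :: nat set"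
      have "?T \<subset> {..<2}"
        using that by (cases r; cases s) (simp_all add: numeral_2_eq_2 lessThan_Suc psubset_eq)
      moreover have "choose_blocks ?T as bs @ x = (if r then b1 else a1) @ (if s then b2 else a2) @ x"
        for x
        by (simp add: choose_blocks_def as bs)
      ultimately show ?thesis
        using hyp[rule_format, of ?T] by (simp add: cube_point_def zero_con_def Id_on_iff)
    qed
    have mem: "?v r s t \<in> I \<times> carrier G \<times> L" for r s t
      using cub by (simp add: cubical_def)
    have "fst (?v True True False) = fst (?v True True True)"
      using cub edge[of False False] unfolding cubical_def
      by (intro uniaxial_edge_eq[of "\<lambda>r s t. fst (?v r s t)"]) simp_all
    moreover have "snd (snd (?v True True False)) = snd (snd (?v True True True))"
      using cub edge[of False False] unfolding cubical_def
      by (intro uniaxial_edge_eq[of "\<lambda>r s t. snd (snd (?v r s t))"]) simp_all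
    moreover have "fst (snd (?v True True False)) = fst (snd (?v True True True))"
    proof (rule balanced_edge_eq[of "\<lambda>r s t. fst (snd (?v r s t))"])
      show "balanced G (\<lambda>r s t. fst (snd (?v r s t)))" using cub by (simp add: cubical_def)
      show "fst (snd (?v r s t)) \<in> carrier G" for r s t using mem[of r s t] by auto
    qed (simp_all add: edge)
    ultimately have "?v True True False = ?v True True True" by (simp add: prod_eq_iff)
    then show "(p (concat bs @ c), p (concat bs @ d)) \<in> zero_con ?A"
      using mem[of True True False]
      by (simp add: bs cube_point_def zero_con_def carr Id_on_iff)
  qed
qed

theorem proposition3p11:
  fixes C\<^sub>2 :: "('g, 'm) monoid_scheme" and e g :: 'g
  assumes "group C\<^sub>2" and "cyclic_group C\<^sub>2"
    and "carrier C\<^sub>2 = {e, g}" and "e \<noteq> g" and "e = \<one>\<^bsub>C\<^sub>2\<^esub>"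
  shows "supernilpotent 2 (S2 C\<^sub>2 g)"
proof -
  interpret comm_group C\<^sub>2
    using assms(1,2) by (rule group.cyclic_imp_abelian_group)
  have "S2_mult C\<^sub>2 g = rees_mult C\<^sub>2 (sandwich C\<^sub>2 g)"
    by (simp add: S2_mult_def rees_mult_def)
  moreover have "sandwich C\<^sub>2 g l i \<in> carrier C\<^sub>2" for l i
    using assms(3) by (auto simp: sandwich_def assms(5))
  ultimately show ?thesis
    unfolding S2_def by (simp add: rees_matrix_supernilpotent)
qed

end
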